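(* Let $n\ge 1$ be an integer and let $r$ be the smallest number such that every $n\times n$ complex matrix is a product of $r$ bidiagonal $n\times n$ complex matrices. Then \[ n-1\le r\le 8n . \]
   Context: An $n\times n$ matrix $A=(a_{ij})$ is called bidiagonal in this convention if $a_{ij}=0$ whenever $|i-j|\ge 2$; that is, nonzero entries are allowed on the main diagonal, the first superdiagonal and the first subdiagonal (what is usually called tridiagonal). *)

theory Defs
  imports Complex_Main "Jordan_Normal_Form.Matrix"
begin

(* The convention used here allows both neighbouring diagonals to be nonzero, so
   "bidiagonal" is what is usually called tridiagonal. *)
definition bidiagonal :: "nat \<Rightarrow> complex mat \<Rightarrow> bool" where
  "bidiagonal n A \<longleftrightarrow> A \<in> carrier_mat n n \<and>
     (\<forall>i<n. \<forall>j<n. \<bar>int i - int j\<bar> \<ge> 2 \<longrightarrow> A $$ (i, j) = 0)"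

(* The argument n is needed because the empty product is the n x n identity matrix. *)
definition mat_list_prod :: "nat \<Rightarrow> complex mat list \<Rightarrow> complex mat" where
  "mat_list_prod n Bs = foldr (*) Bs (1\<^sub>m n)"

definition every_matrix_product_of_bidiagonals :: "nat \<Rightarrow> nat \<Rightarrow> bool" where
  "every_matrix_product_of_bidiagonals n r \<longleftrightarrow>
     (\<forall>A \<in> carrier_mat n n. \<exists>Bs. length Bs = r \<and> (\<forall>B \<in> set Bs. bidiagonal n B) \<and>
        A = mat_list_prod n Bs)"

(* LEAST is only meaningful if some such r exists. *)
definition bidiagonal_product_number :: "nat \<Rightarrow> nat" where
  "bidiagonal_product_number n = (LEAST r. every_matrix_product_of_bidiagonals n r)"

end

theory Submission
  imports Defs "Jordan_Normal_Form.Determinant"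
begin

text \<open>
  Lower bound: a product of \<^term>\<open>r\<close> tridiagonal matrices vanishes at distance more than
  \<^term>\<open>r\<close> from the diagonal, whereas some matrices have a nonzero corner entry at distance
  \<^term>\<open>n - 1\<close> (lemma \<open>every_matrix_product_lower_bound\<close>).

  Upper bound: \<open>4 * n + 1\<close> factors suffice.  Two facts combine.

  First, every square matrix, singular or not, can be written as \<open>U L D U' L'\<close> with unitriangular
  outer factors (\<open>U\<close>, \<open>U'\<close> upper, \<open>L\<close>, \<open>L'\<close> lower) and \<open>D\<close> diagonal (lemma \<open>uldul_exists\<close>).  This
  is Gaussian elimination with complete pivoting in which the pivot is not moved to the corner by
  row and column exchanges; instead its row is added to the first row and its column to the first
  column.  The row additions are upper unitriangular and are absorbed by \<open>U\<close>, the column additions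
  are lower unitriangular and are absorbed by \<open>L'\<close>.

  Second, with \<open>J\<close> the permutation matrix that reverses the order of the indices,
  \<open>U L = (U J) (J L)\<close>, and both factors on the right are zero below the antidiagonal and one on it.
  Any such matrix is a product of only \<^term>\<open>n\<close> tridiagonal ones (lemma
  \<open>northwest_unitriangular_product\<close>).  The reason is that \<^term>\<open>n\<close> rounds of odd-even transpositions
  reverse \<^term>\<open>n\<close> wires in such a way that any two wires cross exactly once.  All transpositions
  of one round are disjoint and adjacent, so a round is a tridiagonal matrix, and it remains so if
  each transposition also adds a multiple of one wire to the other.  There is one free multiple for
  each pair of wires, just as there is one free entry above the antidiagonal, and the multiples can
  be solved for.  (This is the factorisation of the big Bruhat cell along a reduced word of the
  longest permutation, the word being grouped into \<^term>\<open>n\<close> layers of commuting letters.)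

  So \<open>U L\<close> and \<open>U' L'\<close> cost \<open>2 * n\<close> factors each, and \<open>D\<close> is one more.
\<close>

section \<open>Products of tridiagonal matrices and their bandwidth\<close>

definition product_of_bidiagonals :: "nat \<Rightarrow> nat \<Rightarrow> complex mat \<Rightarrow> bool" where
  "product_of_bidiagonals n r A \<longleftrightarrow>
     (\<exists>Bs. length Bs = r \<and> (\<forall>B \<in> set Bs. bidiagonal n B) \<and> A = mat_list_prod n Bs)"

lemma mat_list_prod_simps [simp]:
  "mat_list_prod n [] = 1\<^sub>m n"
  "mat_list_prod n (B # Bs) = B * mat_list_prod n Bs"
  by (simp_all add: mat_list_prod_def)

lemma mat_list_prod_carrier:
  "\<forall>B \<in> set Bs. bidiagonal n B \<Longrightarrow> mat_list_prod n Bs \<in> carrier_mat n n"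
  by (induction Bs) (auto simp: bidiagonal_def)

lemma mat_list_prod_append:
  assumes "\<forall>B \<in> set Bs. bidiagonal n B" "\<forall>C \<in> set Cs. bidiagonal n C"
  shows "mat_list_prod n (Bs @ Cs) = mat_list_prod n Bs * mat_list_prod n Cs"
  using assms
proof (induction Bs)
  case Nil
  then show ?case using mat_list_prod_carrier[of Cs n] by simp
next
  case (Cons B Bs)
  have "B \<in> carrier_mat n n" using Cons.prems by (simp add: bidiagonal_def)
  moreover have "mat_list_prod n Bs \<in> carrier_mat n n" "mat_list_prod n Cs \<in> carrier_mat n n"
    using Cons.prems by (auto intro: mat_list_prod_carrier)
  ultimately show ?case using Cons by (simp add: assoc_mult_mat)
qed

lemma product_of_bidiagonals_mult:
  assumes "product_of_bidiagonals n r A" "product_of_bidiagonals n s B"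
  shows "product_of_bidiagonals n (r + s) (A * B)"
proof -
  obtain As where As: "length As = r" "\<forall>X \<in> set As. bidiagonal n X" "A = mat_list_prod n As"
    using assms(1) by (auto simp: product_of_bidiagonals_def)
  obtain Bs where Bs: "length Bs = s" "\<forall>X \<in> set Bs. bidiagonal n X" "B = mat_list_prod n Bs"
    using assms(2) by (auto simp: product_of_bidiagonals_def)
  show ?thesis unfolding product_of_bidiagonals_def
    using As Bs mat_list_prod_append[of As n Bs] by (intro exI[of _ "As @ Bs"]) auto
qed

lemma product_of_bidiagonals_one: "product_of_bidiagonals n 0 (1\<^sub>m n)"
  by (simp add: product_of_bidiagonals_def)

lemma product_of_bidiagonals_single:
  assumes "bidiagonal n B"
  shows "product_of_bidiagonals n 1 B"
  using assms unfolding product_of_bidiagonals_def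
  by (intro exI[of _ "[B]"]) (auto simp: bidiagonal_def)

text \<open>
  One tridiagonal factor moves an index by at most one.
\<close>
lemma mat_list_prod_band:
  assumes "\<forall>B \<in> set Bs. bidiagonal n B" "i < n" "j < n" "\<bar>int i - int j\<bar> > int (length Bs)"
  shows "mat_list_prod n Bs $$ (i, j) = 0"
  using assms
proof (induction Bs arbitrary: i)
  case Nil
  then show ?case by auto
next
  case (Cons B Bs)
  have B: "B \<in> carrier_mat n n" and band: "\<And>k. k < n \<Longrightarrow> \<bar>int i - int k\<bar> \<ge> 2 \<Longrightarrow> B $$ (i, k) = 0"
    using Cons.prems by (auto simp: bidiagonal_def)
  have P: "mat_list_prod n Bs \<in> carrier_mat n n"
    using Cons.prems by (auto intro: mat_list_prod_carrier)
  have "(B * mat_list_prod n Bs) $$ (i, j) = (\<Sum>k<n. B $$ (i, k) * mat_list_prod n Bs $$ (k, j))"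
    using B P Cons.prems by (simp add: scalar_prod_def atLeast0LessThan)
  also have "\<dots> = 0"
  proof (intro sum.neutral ballI)
    fix k assume k: "k \<in> {..<n}"
    show "B $$ (i, k) * mat_list_prod n Bs $$ (k, j) = 0"
    proof (cases "\<bar>int i - int k\<bar> \<ge> 2")
      case True
      then show ?thesis using band k by simp
    next
      case False
      then have "\<bar>int k - int j\<bar> > int (length Bs)" using Cons.prems(4) by simp
      then show ?thesis using Cons k by simp
    qed
  qed
  finally show ?case by simp
qed

section \<open>Layers of adjacent transpositions\<close>

text \<open>
  Think of column \<^term>\<open>p\<close> of \<^term>\<open>M\<close> as the vector carried by the wire at position \<^term>\<open>p\<close>,
  and of \<^term>\<open>\<pi> p\<close> as the name of that wire.  If wires start in their natural order, pick up
  multiples of the wires that they cross, and never cross twice, then the vector of a wire can only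
  involve the wires of smaller name that it has already crossed, that is, those that now stand to
  its right.  This is the condition below; for the order-reversing \<^term>\<open>\<pi>\<close> it describes all
  matrices that are one on the antidiagonal and zero below it, and for the identity only the
  identity matrix.
\<close>
definition adapted :: "nat \<Rightarrow> (nat \<Rightarrow> nat) \<Rightarrow> complex mat \<Rightarrow> bool" where
  "adapted n \<pi> M \<longleftrightarrow> M \<in> carrier_mat n n \<and>
     (\<forall>p<n. M $$ (\<pi> p, p) = 1 \<and>
        (\<forall>q<n. q \<noteq> p \<longrightarrow> \<not> (p < q \<and> \<pi> q < \<pi> p) \<longrightarrow> M $$ (\<pi> q, p) = 0))"

definition swap_layer :: "nat set \<Rightarrow> nat \<Rightarrow> nat" where
  "swap_layer P p = (if p \<in> P then Suc p else if 0 < p \<and> p - 1 \<in> P then p - 1 else p)"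

text \<open>
  Undoing a round of disjoint adjacent crossings.  The matrix \<^term>\<open>T\<close> consists of blocks with
  rows \<open>(c, 1)\<close> and \<open>(1, 0)\<close> at the positions in \<^term>\<open>P\<close>, and \<^term>\<open>M'\<close> is \<^term>\<open>M\<close> times its inverse.
  When the crossing of two wires is undone, the one with the larger name must no longer involve
  the other; since the other wire has coefficient one at its own name, there is exactly one
  multiple \<^term>\<open>c\<close> of it to subtract, and the subtraction introduces no forbidden entries.
\<close>
lemma adapted_layer:
  assumes M: "adapted n \<pi> M" and ran: "\<And>p. p < n \<Longrightarrow> \<pi> p < n"
    and P: "\<And>p. p \<in> P \<Longrightarrow> Suc p < n \<and> Suc p \<notin> P \<and> \<pi> (Suc p) < \<pi> p"
  obtains M' T where "M = M' * T" "adapted n (\<pi> \<circ> swap_layer P) M'" "bidiagonal n T"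
proof -
  let ?\<sigma> = "swap_layer P"
  define c where "c p = M $$ (\<pi> (Suc p), p)" for p
  define M' where "M' = mat n n (\<lambda>(k, p).
     if p \<in> P then M $$ (k, Suc p)
     else if 0 < p \<and> p - 1 \<in> P then M $$ (k, p - 1) - c (p - 1) * M $$ (k, p)
     else M $$ (k, p))"
  define T where "T = mat n n (\<lambda>(k, p).
     if p \<in> P then (if k = p then c p else if k = Suc p then 1 else 0)
     else if 0 < p \<and> p - 1 \<in> P then (if k = p - 1 then 1 else 0)
     else (if k = p then 1 else (0::complex)))"
  have Mc: "M \<in> carrier_mat n n" and diag: "\<And>p. p < n \<Longrightarrow> M $$ (\<pi> p, p) = 1"
    and off: "\<And>p q. p < n \<Longrightarrow> q < n \<Longrightarrow> q \<noteq> p \<Longrightarrow> \<not> (p < q \<and> \<pi> q < \<pi> p) \<Longrightarrow> M $$ (\<pi> q, p) = 0"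
    using M by (auto simp: adapted_def)
  have \<sigma>n: "?\<sigma> q < n" if "q < n" for q
    using that P by (auto simp: swap_layer_def)
  have "bidiagonal n T"
    by (auto simp: bidiagonal_def T_def)
  moreover have "M = M' * T"
  proof (rule eq_matI)
    fix k p assume "k < dim_row (M' * T)" "p < dim_col (M' * T)"
    then have k: "k < n" and p: "p < n" by (auto simp: M'_def T_def)
    have "(M' * T) $$ (k, p) = (\<Sum>l<n. M' $$ (k, l) * T $$ (l, p))"
      using k p by (simp add: M'_def T_def scalar_prod_def atLeast0LessThan)
    also have "\<dots> = M $$ (k, p)"
    proof (cases "p \<in> P")
      case True
      then have S: "Suc p < n" "Suc p \<notin> P" using P by auto
      have "(\<Sum>l<n. M' $$ (k, l) * T $$ (l, p)) = (\<Sum>l\<in>{p, Suc p}. M' $$ (k, l) * T $$ (l, p))"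
        using S True p by (intro sum.mono_neutral_right) (auto simp: T_def)
      also have "\<dots> = M $$ (k, p)"
        using True S k p by (simp add: T_def M'_def)
      finally show ?thesis .
    next
      case False
      show ?thesis
      proof (cases "0 < p \<and> p - 1 \<in> P")
        case True
        have "(\<Sum>l<n. M' $$ (k, l) * T $$ (l, p)) = (\<Sum>l\<in>{p - 1}. M' $$ (k, l) * T $$ (l, p))"
          using False True p by (intro sum.mono_neutral_right) (auto simp: T_def)
        also have "\<dots> = M $$ (k, p)"
          using True False k p by (simp add: T_def M'_def)
        finally show ?thesis .
      next
        case False': False
        have "(\<Sum>l<n. M' $$ (k, l) * T $$ (l, p)) = (\<Sum>l\<in>{p}. M' $$ (k, l) * T $$ (l, p))"
          using False False' p by (intro sum.mono_neutral_right) (auto simp: T_def)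
        also have "\<dots> = M $$ (k, p)"
          using False' False k p by (auto simp: T_def M'_def)
        finally show ?thesis .
      qed
    qed
    finally show "M $$ (k, p) = (M' * T) $$ (k, p)" by simp
  qed (use Mc in \<open>auto simp: M'_def T_def\<close>)
  moreover have "adapted n (\<pi> \<circ> ?\<sigma>) M'"
    unfolding adapted_def
  proof (intro conjI allI impI)
    show "M' \<in> carrier_mat n n" by (simp add: M'_def)
  next
    fix p assume p: "p < n"
    have r: "\<pi> (?\<sigma> p) < n" using p \<sigma>n ran by blast
    consider "p \<in> P" | p' where "p = Suc p'" "p' \<in> P" "p \<notin> P" | "p \<notin> P" "\<not> (0 < p \<and> p - 1 \<in> P)"
      by (cases p) auto
    then show "M' $$ ((\<pi> \<circ> ?\<sigma>) p, p) = 1"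
    proof cases
      case 1
      then show ?thesis using r p P[of p] diag by (simp add: M'_def swap_layer_def)
    next
      case 2
      then show ?thesis using r p P[of p'] diag[of p'] off[of p p']
        by (simp add: M'_def swap_layer_def)
    next
      case 3
      then have "?\<sigma> p = p" by (auto simp: swap_layer_def)
      then show ?thesis using r p 3 diag by (auto simp: M'_def)
    qed
  next
    fix p q assume p: "p < n" and q: "q < n" and qp: "q \<noteq> p"
      and nc: "\<not> (p < q \<and> (\<pi> \<circ> ?\<sigma>) q < (\<pi> \<circ> ?\<sigma>) p)"
    have r: "\<pi> (?\<sigma> q) < n" and s: "?\<sigma> q < n" using q \<sigma>n ran by blast+
    consider "p \<in> P" | p' where "p = Suc p'" "p' \<in> P" "p \<notin> P" | "p \<notin> P" "\<not> (0 < p \<and> p - 1 \<in> P)"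
      by (cases p) auto
    then show "M' $$ ((\<pi> \<circ> ?\<sigma>) q, p) = 0"
    proof cases
      case 1
      have \<sigma>p: "?\<sigma> p = Suc p" using 1 by (simp add: swap_layer_def)
      have "?\<sigma> q \<noteq> Suc p" using qp 1 P[of p] P[of "Suc p"]
        by (auto simp: swap_layer_def split: if_splits)
      moreover have "p < q" if "Suc p < ?\<sigma> q"
        using that 1 qp by (auto simp: swap_layer_def split: if_splits)
      ultimately have "M $$ (\<pi> (?\<sigma> q), Suc p) = 0"
        using off[of "Suc p" "?\<sigma> q"] s 1 P[of p] nc \<sigma>p by auto
      then show ?thesis using r p 1 by (simp add: M'_def)
    next
      case 2
      have \<sigma>p: "?\<sigma> p = p'" using 2 by (simp add: swap_layer_def)
      have desc: "\<pi> p < \<pi> p'" using P[of p'] 2 by simp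
      have eq: "M' $$ (\<pi> (?\<sigma> q), p) = M $$ (\<pi> (?\<sigma> q), p') - c p' * M $$ (\<pi> (?\<sigma> q), p)"
        using r p 2 by (simp add: M'_def)
      show ?thesis
      proof (cases "q = p'")
        case True
        then have "?\<sigma> q = p" using 2 by (simp add: swap_layer_def)
        then show ?thesis using eq diag[OF p] 2 by (simp add: c_def)
      next
        case False
        have ne: "?\<sigma> q \<noteq> p" "?\<sigma> q \<noteq> p'" using qp False 2 P[of p'] P[of p] P[of q] P[of "q - 1"]
          by (auto simp: swap_layer_def split: if_splits)
        have gt: "p < q" if "p < ?\<sigma> q"
          using that 2 qp False by (auto simp: swap_layer_def split: if_splits)
        have "M $$ (\<pi> (?\<sigma> q), p) = 0"
          using off[of p "?\<sigma> q"] s p ne gt nc \<sigma>p desc by auto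
        moreover have "M $$ (\<pi> (?\<sigma> q), p') = 0"
          using off[of p' "?\<sigma> q"] s p 2(1) ne gt nc \<sigma>p by auto
        ultimately show ?thesis using eq by simp
      qed
    next
      case 3
      then have \<sigma>p: "?\<sigma> p = p" by (auto simp: swap_layer_def)
      have "?\<sigma> q \<noteq> p" 
      proof
        assume "?\<sigma> q = p"
        with qp 3 show False by (auto simp: swap_layer_def split: if_splits)
      qed
      moreover have "p < q" if "p < ?\<sigma> q"
        using that 3 qp by (cases "q = p") (auto simp: swap_layer_def less_Suc_eq split: if_splits)
      ultimately have "M $$ (\<pi> (?\<sigma> q), p) = 0"
        using off[of p "?\<sigma> q"] s p nc \<sigma>p by auto
      then show ?thesis using r p 3 by (auto simp: M'_def)
    qed
  qed
  ultimately show ?thesis using that by blast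
qed

section \<open>The odd-even transposition network\<close>

text \<open>
  The wire that stands at position \<^term>\<open>p\<close> after \<^term>\<open>t\<close> rounds, if round \<open>t + 1\<close> exchanges the
  positions \<open>p\<close> and \<open>p + 1\<close> for all \<open>p\<close> of the same parity as \<^term>\<open>t\<close>.  Each wire travels in one
  direction until it is reflected at an end.  Unfold the positions to a circle of length
  \<open>2 * n\<close>, where position \<^term>\<open>p\<close> is represented by both \<open>p\<close> (moving right) and \<open>2 * n - 1 - p\<close>
  (moving left): all wires then start at even points and advance by one in every round.  The formula
  takes the representative with the parity of \<^term>\<open>t\<close>, goes back \<^term>\<open>t\<close> steps and folds again.  It is
  meant for \<open>t \<le> n\<close>, when at most one reflection has occurred.
\<close>
definition wire_at :: "nat \<Rightarrow> nat \<Rightarrow> nat \<Rightarrow> nat" where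
  "wire_at n t p =
     (if even (p + t) then (if t \<le> p then p - t else t - p - 1)
      else (if p + t < n then p + t else 2 * n - 1 - p - t))"

lemma wire_at_less: "t \<le> n \<Longrightarrow> p < n \<Longrightarrow> wire_at n t p < n"
  by (auto simp: wire_at_def)

text \<open>
  The wires that met in the last round had their names in increasing order before it, so no pair
  crosses twice within \<^term>\<open>n\<close> rounds.
\<close>
lemma wire_at_descent:
  assumes "Suc t \<le> n" "Suc p < n" "even (p + t)"
  shows "wire_at n (Suc t) (Suc p) < wire_at n (Suc t) p"
  using assms by (auto simp: wire_at_def)

lemma wire_at_step:
  assumes "Suc t \<le> n" "p < n"
  shows "wire_at n t p = wire_at n (Suc t) (swap_layer {p. Suc p < n \<and> even (p + t)} p)"
proof (cases p)
  case 0
  then show ?thesis using assms by (auto simp: wire_at_def swap_layer_def)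
next
  case (Suc p')
  then show ?thesis using assms
    by (cases "even (p + t)"; cases "Suc p < n") (auto simp: wire_at_def swap_layer_def)
qed

lemma adapted_cong:
  assumes "\<And>p. p < n \<Longrightarrow> \<pi> p = \<rho> p"
  shows "adapted n \<pi> M \<longleftrightarrow> adapted n \<rho> M"
  using assms by (simp add: adapted_def)


text \<open>
  Undoing one round splits off one tridiagonal factor, and before the first round only the identity
  matrix is left.
\<close>
lemma adapted_wire_at_product:
  assumes "t \<le> n" "adapted n (wire_at n t) M"
  shows "product_of_bidiagonals n t M"
  using assms
proof (induction t arbitrary: M)
  case 0
  have "M = 1\<^sub>m n"
  proof (rule eq_matI)
    fix k p assume kp: "k < dim_row (1\<^sub>m n)" "p < dim_col (1\<^sub>m n)"
    have "wire_at n 0 q = q" if "q < n" for q using that by (simp add: wire_at_def)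
    then show "M $$ (k, p) = 1\<^sub>m n $$ (k, p)"
      using 0 kp by (auto simp: adapted_def)
  qed (use 0 in \<open>auto simp: adapted_def\<close>)
  then show ?case using product_of_bidiagonals_one by simp
next
  case (Suc t)
  let ?P = "{p. Suc p < n \<and> even (p + t)}"
  obtain M' T where MT: "M = M' * T" "adapted n (wire_at n (Suc t) \<circ> swap_layer ?P) M'" "bidiagonal n T"
  proof (rule adapted_layer[OF Suc.prems(2), of ?P])
    show "wire_at n (Suc t) p < n" if "p < n" for p
      using that Suc.prems wire_at_less by blast
    show "Suc p < n \<and> Suc p \<notin> ?P \<and> wire_at n (Suc t) (Suc p) < wire_at n (Suc t) p" if "p \<in> ?P" for p
      using that wire_at_descent[of t n p] Suc.prems by auto
  qed
  have "adapted n (wire_at n t) M'"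
    using MT(2) adapted_cong[of n "wire_at n t" "wire_at n (Suc t) \<circ> swap_layer ?P" M']
      wire_at_step[of t n] Suc.prems by simp
  then have "product_of_bidiagonals n t M'" using Suc by simp
  from product_of_bidiagonals_mult[OF this product_of_bidiagonals_single[OF MT(3)]]
  show ?case using MT(1) by simp
qed

definition northwest_unitriangular :: "nat \<Rightarrow> complex mat \<Rightarrow> bool" where
  "northwest_unitriangular n W \<longleftrightarrow> W \<in> carrier_mat n n \<and>
     (\<forall>i<n. \<forall>j<n. (i + j = n - 1 \<longrightarrow> W $$ (i, j) = 1) \<and> (i + j \<ge> n \<longrightarrow> W $$ (i, j) = 0))"

lemma northwest_unitriangular_product:
  assumes "northwest_unitriangular n W"
  shows "product_of_bidiagonals n n W"
proof (rule adapted_wire_at_product)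
  have rev: "wire_at n n p = n - 1 - p" if "p < n" for p
    using that by (auto simp: wire_at_def)
  show "adapted n (wire_at n n) W"
    using assms by (auto simp: adapted_def rev northwest_unitriangular_def)
qed simp

section \<open>Unitriangular matrices\<close>

definition unit_upper :: "nat \<Rightarrow> complex mat \<Rightarrow> bool" where
  "unit_upper n U \<longleftrightarrow> U \<in> carrier_mat n n \<and> (\<forall>i<n. U $$ (i, i) = 1 \<and> (\<forall>j<i. U $$ (i, j) = 0))"

definition unit_lower :: "nat \<Rightarrow> complex mat \<Rightarrow> bool" where
  "unit_lower n L \<longleftrightarrow> L \<in> carrier_mat n n \<and> (\<forall>j<n. L $$ (j, j) = 1 \<and> (\<forall>i<j. L $$ (i, j) = 0))"

lemma unit_lower_transpose: "unit_lower n L \<longleftrightarrow> unit_upper n (transpose_mat L)"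
  by (auto simp: unit_lower_def unit_upper_def)

text \<open>
  Insert the square of the reversal matrix \<open>J\<close> between the two factors: \<open>V = U J\<close> is \<^term>\<open>U\<close> with its
  columns reversed, and \<open>W = J L\<close> is \<^term>\<open>L\<close> with its rows reversed.
\<close>
lemma unit_upper_lower_product:
  assumes U: "unit_upper n U" and L: "unit_lower n L"
  shows "product_of_bidiagonals n (n + n) (U * L)"
proof -
  define V where "V = mat n n (\<lambda>(i, j). U $$ (i, n - 1 - j))"
  define W where "W = mat n n (\<lambda>(i, j). L $$ (n - 1 - i, j))"
  have "northwest_unitriangular n V"
    unfolding northwest_unitriangular_def
  proof (intro conjI allI impI)
    fix i j assume "i < n" "j < n" "i + j = n - 1"
    moreover from this have "n - 1 - j = i" by simp
    ultimately show "V $$ (i, j) = 1" using U by (simp add: V_def unit_upper_def)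
  qed (use U in \<open>auto simp: V_def unit_upper_def\<close>)
  moreover have "northwest_unitriangular n W"
    unfolding northwest_unitriangular_def
  proof (intro conjI allI impI)
    fix i j assume "i < n" "j < n" "i + j = n - 1"
    moreover from this have "n - 1 - i = j" by simp
    ultimately show "W $$ (i, j) = 1" using L by (simp add: W_def unit_lower_def)
  qed (use L in \<open>auto simp: W_def unit_lower_def\<close>)
  moreover have "U * L = V * W"
  proof (rule eq_matI)
    fix i j assume "i < dim_row (V * W)" "j < dim_col (V * W)"
    then have ij: "i < n" "j < n" by (auto simp: V_def W_def)
    have "(U * L) $$ (i, j) = (\<Sum>k<n. U $$ (i, k) * L $$ (k, j))"
      using U L ij by (auto simp: unit_upper_def unit_lower_def scalar_prod_def atLeast0LessThan)
    also have "\<dots> = (\<Sum>k<n. U $$ (i, n - Suc k) * L $$ (n - Suc k, j))"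
      by (rule sum.nat_diff_reindex[symmetric])
    also have "\<dots> = (V * W) $$ (i, j)"
      using ij by (simp add: V_def W_def scalar_prod_def atLeast0LessThan)
    finally show "(U * L) $$ (i, j) = (V * W) $$ (i, j)" .
  qed (use U L in \<open>auto simp: V_def W_def unit_upper_def unit_lower_def\<close>)
  ultimately show ?thesis
    using northwest_unitriangular_product product_of_bidiagonals_mult by metis
qed

lemma unit_upper_mult:
  assumes U: "unit_upper n U" and V: "unit_upper n V"
  shows "unit_upper n (U * V)"
proof -
  have c: "U \<in> carrier_mat n n" "V \<in> carrier_mat n n" using assms by (auto simp: unit_upper_def)
  have entry: "(U * V) $$ (i, j) = (\<Sum>k\<in>{i..j}. U $$ (i, k) * V $$ (k, j))" if "i < n" "j < n" for i j
  proof -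
    have "(U * V) $$ (i, j) = (\<Sum>k<n. U $$ (i, k) * V $$ (k, j))"
      using c that by (simp add: scalar_prod_def atLeast0LessThan)
    also have "\<dots> = (\<Sum>k\<in>{i..j}. U $$ (i, k) * V $$ (k, j))"
      using that U V by (intro sum.mono_neutral_right) (auto simp: unit_upper_def not_le)
    finally show ?thesis .
  qed
  show ?thesis
    using U V c by (auto simp: unit_upper_def entry simp del: index_mult_mat(1))
qed

lemma unit_lower_mult:
  assumes "unit_lower n L" "unit_lower n M"
  shows "unit_lower n (L * M)"
proof -
  have "transpose_mat (L * M) = transpose_mat M * transpose_mat L"
    using assms by (intro transpose_mult) (auto simp: unit_lower_def)
  then show ?thesis using assms unit_upper_mult by (simp add: unit_lower_transpose)
qed

lemma unit_upper_right_inverse: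
  assumes "unit_upper n U"
  obtains V where "V \<in> carrier_mat n n" "U * V = 1\<^sub>m n"
proof -
  have c: "U \<in> carrier_mat n n" using assms by (simp add: unit_upper_def)
  have "det U = prod_list (diag_mat U)"
    using assms c by (intro det_upper_triangular) (auto simp: unit_upper_def upper_triangular_def)
  also have "\<dots> = 1"
    using assms c unfolding prod_list_diag_prod by (auto simp: unit_upper_def)
  finally have "U \<in> Units (ring_mat TYPE(complex) n ())"
    using det_non_zero_imp_unit[OF c] by simp
  then show ?thesis using that by (auto simp: Units_def ring_mat_def)
qed

lemma unit_lower_left_inverse:
  assumes "unit_lower n L"
  obtains V where "V \<in> carrier_mat n n" "V * L = 1\<^sub>m n"
proof -
  have c: "L \<in> carrier_mat n n" using assms by (simp add: unit_lower_def)
  obtain V where V: "V \<in> carrier_mat n n" "transpose_mat L * V = 1\<^sub>m n"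
    using assms unit_upper_right_inverse unfolding unit_lower_transpose by metis
  have "transpose_mat V * L = transpose_mat (transpose_mat L * V)"
    
    by (subst transpose_mult[of _ n n _ n]) (use V c in auto)
  also have "\<dots> = 1\<^sub>m n" by (simp only: V(2) transpose_one)
  finally show ?thesis by (rule that[rotated]) (use V in simp)
qed

section \<open>Elimination without exchanges\<close>

text \<open>
  The middle factor may have zeros on the diagonal, so that singular matrices are covered.
\<close>
definition uldul :: "nat \<Rightarrow> complex mat \<Rightarrow> bool" where
  "uldul n A \<longleftrightarrow> (\<exists>U L D U' L'. unit_upper n U \<and> unit_lower n L \<and> D \<in> carrier_mat n n \<and>
     diagonal_mat D \<and> unit_upper n U' \<and> unit_lower n L' \<and> A = (U * L) * D * (U' * L'))"

lemma uldul_mult_unit_upper: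
  assumes "unit_upper n V" "uldul n A"
  shows "uldul n (V * A)"
proof -
  obtain U L D U' L' where *: "unit_upper n U" "unit_lower n L" "D \<in> carrier_mat n n"
    "diagonal_mat D" "unit_upper n U'" "unit_lower n L'" "A = (U * L) * D * (U' * L')"
    using assms(2) unfolding uldul_def by blast
  have c: "V \<in> carrier_mat n n" "U \<in> carrier_mat n n" "L \<in> carrier_mat n n"
    "U' \<in> carrier_mat n n" "L' \<in> carrier_mat n n"
    using * assms(1) by (auto simp: unit_upper_def unit_lower_def)
  have "V * A = ((V * U) * L) * D * (U' * L')"
    using c *(3,7) by (simp add: assoc_mult_mat[of _ n n _ n _ n])
  then show ?thesis
    unfolding uldul_def using * unit_upper_mult[OF assms(1) *(1)] by blast
qed

lemma uldul_mult_unit_lower: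
  assumes "unit_lower n M" "uldul n A"
  shows "uldul n (A * M)"
proof -
  obtain U L D U' L' where *: "unit_upper n U" "unit_lower n L" "D \<in> carrier_mat n n"
    "diagonal_mat D" "unit_upper n U'" "unit_lower n L'" "A = (U * L) * D * (U' * L')"
    using assms(2) unfolding uldul_def by blast
  have c: "M \<in> carrier_mat n n" "U \<in> carrier_mat n n" "L \<in> carrier_mat n n"
    "U' \<in> carrier_mat n n" "L' \<in> carrier_mat n n"
    using * assms(1) by (auto simp: unit_upper_def unit_lower_def)
  have "A * M = (U * L) * D * (U' * (L' * M))"
    using c *(3,7) by (simp add: assoc_mult_mat[of _ n n _ n _ n])
  then show ?thesis
    unfolding uldul_def using * unit_lower_mult[OF *(6) assms(1)] by blast
qed


lemma uldul_zero: "uldul n (0\<^sub>m n n)"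
proof -
  have "unit_upper n (1\<^sub>m n)" "unit_lower n (1\<^sub>m n)"
    by (auto simp: unit_upper_def unit_lower_def)
  moreover have "diagonal_mat (0\<^sub>m n n :: complex mat)" by (simp add: diagonal_mat_def)
  moreover have "0\<^sub>m n n = (1\<^sub>m n * 1\<^sub>m n) * 0\<^sub>m n n * (1\<^sub>m n * 1\<^sub>m n :: complex mat)" by simp
  ultimately show ?thesis unfolding uldul_def using zero_carrier_mat by blast
qed

text \<open>
  A nonzero corner entry \<^term>\<open>\<alpha>\<close> is split off by block elimination, and the factors of the Schur
  complement are bordered.  The usual elimination factors would stand outside the factors of the
  complement, with the first column \<open>Y / \<alpha>\<close> to the left of \<^term>\<open>U\<close>, where a lower factor is not
  allowed.  To move it past \<^term>\<open>U\<close> into the border of \<^term>\<open>L\<close>, one has to solve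
  \<open>U l = Y / \<alpha>\<close>; symmetrically for the first row, \<open>r L' = X / \<alpha>\<close>.
\<close>
lemma uldul_schur_complement:
  assumes \<alpha>: "\<alpha> \<noteq> 0" and X: "X \<in> carrier_mat 1 n" and Y: "Y \<in> carrier_mat n 1"
    and B: "B \<in> carrier_mat n n" and S: "uldul n (B - (1 / \<alpha>) \<cdot>\<^sub>m (Y * X))"
  shows "uldul (Suc n) (four_block_mat (\<alpha> \<cdot>\<^sub>m 1\<^sub>m 1) X Y B)"
proof -
  obtain U L D U' L' where *: "unit_upper n U" "unit_lower n L" "D \<in> carrier_mat n n"
    "diagonal_mat D" "unit_upper n U'" "unit_lower n L'"
    "B - (1 / \<alpha>) \<cdot>\<^sub>m (Y * X) = (U * L) * D * (U' * L')"
    using S unfolding uldul_def by blast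
  obtain V where V: "V \<in> carrier_mat n n" "U * V = 1\<^sub>m n"
    using unit_upper_right_inverse[OF *(1)] .
  obtain V' where V': "V' \<in> carrier_mat n n" "V' * L' = 1\<^sub>m n"
    using unit_lower_left_inverse[OF *(6)] .
  have c: "U \<in> carrier_mat n n" "L \<in> carrier_mat n n"
    "U' \<in> carrier_mat n n" "L' \<in> carrier_mat n n"
    using * by (auto simp: unit_upper_def unit_lower_def)
  define l where "l = V * ((1 / \<alpha>) \<cdot>\<^sub>m Y)"
  define r where "r = ((1 / \<alpha>) \<cdot>\<^sub>m X) * V'"
  have lc: "l \<in> carrier_mat n 1" and rc: "r \<in> carrier_mat 1 n"
    using V V' X Y by (auto simp: l_def r_def)
  have Ul: "U * l = (1 / \<alpha>) \<cdot>\<^sub>m Y"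
    using V c Y by (simp add: l_def assoc_mult_mat[of U n n V n _ 1, symmetric])
  have rL: "r * L' = (1 / \<alpha>) \<cdot>\<^sub>m X"
    using V' c X by (simp add: r_def assoc_mult_mat[of _ 1 n V' n L' n])
  let ?U = "four_block_mat (1\<^sub>m 1) (0\<^sub>m 1 n) (0\<^sub>m n 1) U"
  let ?L = "four_block_mat (1\<^sub>m 1) (0\<^sub>m 1 n) l L"
  let ?D = "four_block_mat (\<alpha> \<cdot>\<^sub>m 1\<^sub>m 1) (0\<^sub>m 1 n) (0\<^sub>m n 1) D"
  let ?U' = "four_block_mat (1\<^sub>m 1) r (0\<^sub>m n 1) U'"
  let ?L' = "four_block_mat (1\<^sub>m 1) (0\<^sub>m 1 n) (0\<^sub>m n 1) L'"
  have "?U * ?L = four_block_mat (1\<^sub>m 1) (0\<^sub>m 1 n) ((1 / \<alpha>) \<cdot>\<^sub>m Y) (U * L)"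
    using c lc Y by (subst mult_four_block_mat[of _ 1 1 _ n _ n _ _ 1 _ n]) (auto simp: Ul)
  moreover have "?U' * ?L' = four_block_mat (1\<^sub>m 1) ((1 / \<alpha>) \<cdot>\<^sub>m X) (0\<^sub>m n 1) (U' * L')"
    using c rc X by (subst mult_four_block_mat[of _ 1 1 _ n _ n _ _ 1 _ n]) (auto simp: rL)
  moreover have "four_block_mat (1\<^sub>m 1) (0\<^sub>m 1 n) ((1 / \<alpha>) \<cdot>\<^sub>m Y) (U * L) * ?D
      = four_block_mat (\<alpha> \<cdot>\<^sub>m 1\<^sub>m 1) (0\<^sub>m 1 n) Y (U * L * D)"
  proof -
    have "((1 / \<alpha>) \<cdot>\<^sub>m Y) * (\<alpha> \<cdot>\<^sub>m 1\<^sub>m 1) = Y"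
      using \<alpha> Y by (intro eq_matI) (auto simp: mult_smult_distrib[of _ n 1 _ 1])
    then show ?thesis
      using c *(3) Y by (subst mult_four_block_mat[of _ 1 1 _ n _ n _ _ 1 _ n]) auto
  qed
  moreover have "four_block_mat (\<alpha> \<cdot>\<^sub>m 1\<^sub>m 1) (0\<^sub>m 1 n) Y (U * L * D) *
      four_block_mat (1\<^sub>m 1) ((1 / \<alpha>) \<cdot>\<^sub>m X) (0\<^sub>m n 1) (U' * L')
      = four_block_mat (\<alpha> \<cdot>\<^sub>m 1\<^sub>m 1) X Y B"
  proof -
    have 1: "(\<alpha> \<cdot>\<^sub>m 1\<^sub>m 1) * ((1 / \<alpha>) \<cdot>\<^sub>m X) = X"
      using \<alpha> X by (intro eq_matI) (auto simp: mult_smult_assoc_mat[of _ 1 1 _ n])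
    have 2: "Y * ((1 / \<alpha>) \<cdot>\<^sub>m X) + U * L * D * (U' * L') = B"
      using X Y B unfolding *(7)[symmetric] mult_smult_distrib[OF Y X]
      by (intro eq_matI) auto
    have "four_block_mat (\<alpha> \<cdot>\<^sub>m 1\<^sub>m 1) (0\<^sub>m 1 n) Y (U * L * D) *
        four_block_mat (1\<^sub>m 1) ((1 / \<alpha>) \<cdot>\<^sub>m X) (0\<^sub>m n 1) (U' * L')
      = four_block_mat ((\<alpha> \<cdot>\<^sub>m 1\<^sub>m 1) * 1\<^sub>m 1 + 0\<^sub>m 1 n * 0\<^sub>m n 1)
          ((\<alpha> \<cdot>\<^sub>m 1\<^sub>m 1) * ((1 / \<alpha>) \<cdot>\<^sub>m X) + 0\<^sub>m 1 n * (U' * L'))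
          (Y * 1\<^sub>m 1 + U * L * D * 0\<^sub>m n 1) (Y * ((1 / \<alpha>) \<cdot>\<^sub>m X) + U * L * D * (U' * L'))"
      using c *(3) X Y by (intro mult_four_block_mat[of _ 1 1 _ n _ n _ _ 1 _ n]) auto
    also have "\<dots> = four_block_mat (\<alpha> \<cdot>\<^sub>m 1\<^sub>m 1) X Y B"
      unfolding 1 2 using c *(3) X Y by (intro cong_four_block_mat) auto
    finally show ?thesis .
  qed
  ultimately have "four_block_mat (\<alpha> \<cdot>\<^sub>m 1\<^sub>m 1) X Y B = (?U * ?L) * ?D * (?U' * ?L')"
    by simp
  moreover have "unit_upper (Suc n) ?U" "unit_upper (Suc n) ?U'"
    using *(1,5) rc by (auto simp: unit_upper_def)
  moreover have "unit_lower (Suc n) ?L" "unit_lower (Suc n) ?L'"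
    using *(2,6) lc by (auto simp: unit_lower_def)
  moreover have "?D \<in> carrier_mat (Suc n) (Suc n)" "diagonal_mat ?D"
    using *(3,4) by (auto simp: diagonal_mat_def)
  ultimately show ?thesis unfolding uldul_def by blast
qed

lemma uldul_addrow:
  assumes A: "A \<in> carrier_mat n n" and i: "0 < i" "i < n" and *: "uldul n (addrow c 0 i A)"
  shows "uldul n A"
proof -
  have "uldul n (addrow_mat n (- c) 0 i * addrow c 0 i A)"
    using i by (intro uldul_mult_unit_upper *) (auto simp: unit_upper_def addrow_mat_def)
  also have "addrow_mat n (- c) 0 i * addrow c 0 i A = addrow_mat n (- c) 0 i * addrow_mat n c 0 i * A"
    using A i by (simp add: addrow_mat[OF A] assoc_mult_mat[of _ n n _ n A n])
  also have "\<dots> = A"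
    using addrow_mat_inv[of 0 n i "- c"] A i by simp
  finally show ?thesis .
qed

lemma uldul_addcol:
  assumes A: "A \<in> carrier_mat n n" and j: "0 < j" "j < n" and *: "uldul n (addcol c 0 j A)"
  shows "uldul n A"
proof -
  have "uldul n (addcol c 0 j A * addrow_mat n (- c) j 0)"
    using j by (intro uldul_mult_unit_lower *) (auto simp: unit_lower_def addrow_mat_def)
  also have "addcol c 0 j A * addrow_mat n (- c) j 0 = A * (addrow_mat n c j 0 * addrow_mat n (- c) j 0)"
    using A j by (simp add: addcol_mat[OF A] assoc_mult_mat[of A n n _ n _ n])
  also have "\<dots> = A"
    using addrow_mat_inv[of j n 0 c] A j by simp
  finally show ?thesis .
qed

text \<open>
  If the matrix is not zero, adding the row and then the column of a nonzero entry to the first ones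
  makes the corner nonzero.  An addition is only made when the target entry is zero, so that there is
  no cancellation and the factor one always works.
\<close>
lemma uldul_exists:
  assumes "A \<in> carrier_mat n n"
  shows "uldul n A"
  using assms
proof (induction n arbitrary: A)
  case 0
  then have "A = 0\<^sub>m 0 0" by (intro eq_matI) auto
  then show ?case using uldul_zero by simp
next
  case (Suc n)
  have corner: "uldul (Suc n) A"
    if A: "A \<in> carrier_mat (Suc n) (Suc n)" and nz: "A $$ (0, 0) \<noteq> 0" for A
  proof -
    define X where "X = mat 1 n (\<lambda>(i, j). A $$ (0, Suc j))"
    define Y where "Y = mat n 1 (\<lambda>(i, j). A $$ (Suc i, 0))"
    define B where "B = mat n n (\<lambda>(i, j). A $$ (Suc i, Suc j))"
    have "A = four_block_mat (A $$ (0, 0) \<cdot>\<^sub>m 1\<^sub>m 1) X Y B"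
      using A by (intro eq_matI) (auto simp: X_def Y_def B_def)
    moreover have "uldul (Suc n) (four_block_mat (A $$ (0, 0) \<cdot>\<^sub>m 1\<^sub>m 1) X Y B)"
      using nz by (intro uldul_schur_complement Suc.IH) (auto simp: X_def Y_def B_def)
    ultimately show ?thesis by simp
  qed
  have row: "uldul (Suc n) A"
    if A: "A \<in> carrier_mat (Suc n) (Suc n)" and j: "j < Suc n" and nz: "A $$ (0, j) \<noteq> 0" for A j
  proof (cases "A $$ (0, 0) = 0")
    case True
    with nz have "0 < j" by (cases j) auto
    moreover have "uldul (Suc n) (addcol 1 0 j A)"
      using A j nz True by (intro corner) (auto simp: mat_addcol_def)
    ultimately show ?thesis using uldul_addcol A j by blast
  qed (use A corner in auto)
  show ?case
  proof (cases "A = 0\<^sub>m (Suc n) (Suc n)")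
    case True
    then show ?thesis using uldul_zero by simp
  next
    case False
    then obtain i j where ij: "i < Suc n" "j < Suc n" "A $$ (i, j) \<noteq> 0"
      using Suc.prems by (metis carrier_matD eq_matI index_zero_mat)
    show ?thesis
    proof (cases "A $$ (0, j) = 0")
      case True
      with ij have "0 < i" by (cases i) auto
      moreover have "uldul (Suc n) (addrow 1 0 i A)"
        using Suc.prems ij True by (intro row[of _ j]) auto
      ultimately show ?thesis using uldul_addrow Suc.prems ij by blast
    qed (use Suc.prems ij row in blast)
  qed
qed

section \<open>The two bounds\<close>

lemma every_matrix_product_4n_plus_1: "every_matrix_product_of_bidiagonals n (4 * n + 1)"
  unfolding every_matrix_product_of_bidiagonals_def
proof
  fix A :: "complex mat" assume "A \<in> carrier_mat n n"
  then obtain U L D U' L' where *: "unit_upper n U" "unit_lower n L" "D \<in> carrier_mat n n"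
    "diagonal_mat D" "unit_upper n U'" "unit_lower n L'" "A = (U * L) * D * (U' * L')"
    using uldul_exists unfolding uldul_def by blast
  have "bidiagonal n D"
    using *(3,4) by (auto simp: bidiagonal_def diagonal_mat_def)
  then have "product_of_bidiagonals n ((n + n + 1) + (n + n)) A"
    unfolding *(7) using *
    by (intro product_of_bidiagonals_mult unit_upper_lower_product product_of_bidiagonals_single)
  moreover have "(n + n + 1) + (n + n) = 4 * n + 1" by simp
  ultimately show "\<exists>Bs. length Bs = 4 * n + 1 \<and> (\<forall>B\<in>set Bs. bidiagonal n B) \<and> A = mat_list_prod n Bs"
    unfolding product_of_bidiagonals_def by metis
qed

lemma every_matrix_product_lower_bound:
  assumes "every_matrix_product_of_bidiagonals n r" "n \<ge> 1"
  shows "n - 1 \<le> r"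
proof (rule ccontr)
  assume less: "\<not> n - 1 \<le> r"
  define E where "E = mat n n (\<lambda>(i, j). 1 :: complex)"
  obtain Bs where Bs: "length Bs = r" "\<forall>B \<in> set Bs. bidiagonal n B" "E = mat_list_prod n Bs"
    using assms(1) unfolding every_matrix_product_of_bidiagonals_def E_def by (meson mat_carrier)
  have "E $$ (0, n - 1) = 0"
    unfolding Bs(3) using Bs less assms(2) by (intro mat_list_prod_band) auto
  then show False using assms(2) by (simp add: E_def)
qed

theorem theorem5p4:
  fixes n :: nat
  assumes "n \<ge> 1"
  shows "(\<exists>r. every_matrix_product_of_bidiagonals n r) \<and>
    n - 1 \<le> bidiagonal_product_number n \<and> bidiagonal_product_number n \<le> 8 * n"
proof (intro conjI)
  show ex: "\<exists>r. every_matrix_product_of_bidiagonals n r"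
    using every_matrix_product_4n_plus_1 by blast
  have "every_matrix_product_of_bidiagonals n (bidiagonal_product_number n)"
    unfolding bidiagonal_product_number_def using ex by (rule LeastI_ex)
  then show "n - 1 \<le> bidiagonal_product_number n"
    using every_matrix_product_lower_bound assms by blast
  have "bidiagonal_product_number n \<le> 4 * n + 1"
    unfolding bidiagonal_product_number_def
    using every_matrix_product_4n_plus_1 by (rule Least_le)
  then show "bidiagonal_product_number n \<le> 8 * n" using assms by simp
qed

end
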